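(* Let $n\ge 3$ and $s\ge 1$ be integers. If $s$ is even, then $\xi(n,s)\ge n\lfloor s/2\rfloor+1$. If $s$ is odd, then $\xi(n,s)\ge n\lfloor s/2\rfloor+3$.
   Context: Sequences are finite words over an alphabet; a sequence on a given alphabet takes its letters from that alphabet (not every letter is required to appear). Two sequences are isomorphic if one is obtained from the other by a one-to-one renaming of letters. A sequence contains a copy of $u$ if some (not necessarily contiguous) subsequence of it is isomorphic to $u$; otherwise it is $u$-free. A sequence is $2$-sparse if no two adjacent letters are equal. For an integer $s\ge 0$, $u_s=xyxy\dots$ is the alternating sequence on two distinct letters $x,y$ of length $s+2$. A sequence on a given alphabet is $u_s$-saturated if it is $2$-sparse, $u_s$-free, and inserting any letter of the alphabet at any position (including the beginning or the end) violates $2$-sparsity or creates a copy of $u_s$. $\xi(n,s)$ denotes the minimum possible length of a $u_s$-saturated sequence on an alphabet of size $n$. *)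

theory Defs
  imports Main "HOL-Library.Sublist"
begin

definition seq_iso :: "'a list \<Rightarrow> 'b list \<Rightarrow> bool" where
  "seq_iso u v \<longleftrightarrow> (\<exists>f. inj_on f (set u) \<and> v = map f u)"

definition contains_copy :: "'a list \<Rightarrow> 'b list \<Rightarrow> bool" where
  "contains_copy w u \<longleftrightarrow> (\<exists>v. subseq v w \<and> seq_iso u v)"

abbreviation seq_free :: "'b list \<Rightarrow> 'a list \<Rightarrow> bool" where
  "seq_free u w \<equiv> \<not> contains_copy w u"

text \<open>The two letters x and y of the alternation are represented by 0 and 1.\<close>

definition alt_seq :: "nat \<Rightarrow> nat list" where
  "alt_seq s = map (\<lambda>i. if even i then 0 else 1) [0..<s + 2]"

text \<open>Being 2-sparse is \<^const>\<open>distinct_adj\<close>. The letters of \<open>w\<close> lie in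
  the alphabet \<open>A\<close>, but need not exhaust it; the inserted letter ranges over all of \<open>A\<close>.\<close>

definition alt_saturated :: "'a set \<Rightarrow> nat \<Rightarrow> 'a list \<Rightarrow> bool" where
  "alt_saturated A s w \<longleftrightarrow>
     set w \<subseteq> A \<and> distinct_adj w \<and> seq_free (alt_seq s) w \<and>
     (\<forall>x\<in>A. \<forall>p q. w = p @ q \<longrightarrow>
        \<not> distinct_adj (p @ x # q) \<or> contains_copy (p @ x # q) (alt_seq s))"

text \<open>The alphabet is a set of \<open>n\<close> natural numbers, which loses no generality because
  saturation is invariant under renaming letters. If no saturated sequence existed, the value
  would be unspecified; lower bounds on it therefore also require existence.\<close>

definition \<xi> :: "nat \<Rightarrow> nat \<Rightarrow> nat" where
  "\<xi> n s = (LEAST l. \<exists>(A :: nat set) w.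
     finite A \<and> card A = n \<and> alt_saturated A s w \<and> length w = l)"

end

theory Submission
  imports Defs
begin

text \<open>Let \<open>w\<close> be saturated over \<open>n \<ge> 3\<close> letters. The bound comes from counting occurrences:
  an inserted letter \<open>x\<close> has to be one of the two letters of the forbidden alternation that it
  creates, and each of these two occurs there about half of \<open>s + 2\<close> times, so \<open>x\<close> occurs
  often in \<open>w\<close> already, and so does its partner, all of whose occurrences were present before.

  Insertion at the front is the most informative. It is possible for every letter except the first
  letter of \<open>w\<close>, and the new alternation has to start with the inserted letter, which
  therefore takes the larger half. Hence every letter other than the first one occurs at least
  \<open>\<lceil>s/2\<rceil>\<close> times (lemma \<open>count_of_nonfirst_letter\<close>). The first letter \<open>x\<close> either cannot be
  inserted anywhere, and then occupies at least half of \<open>w\<close>, or can be inserted and then shares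
  \<open>s + 1\<close> occurrences with some partner (lemma \<open>count_of_first_letter\<close>). Both ways the average
  number of occurrences is at least \<open>\<lceil>s/2\<rceil>\<close>, so that \<open>w\<close> has at least
  \<open>n\<lceil>s/2\<rceil>\<close> letters. For odd \<open>s\<close> this is \<open>n\<lfloor>s/2\<rfloor> + n\<close>. For even \<open>s\<close> the partner of any inserted
  letter has \<open>s/2 + 1\<close> occurrences, one more than the average requires.

  The minimum \<open>\<xi> n s\<close> is attained because saturated sequences exist: a longest \<open>2\<close>-sparse
  sequence avoiding the alternation is saturated, and the lengths of such sequences are bounded, as
  in a long one some ordered pair of letters occupies many adjacent positions
  (lemma \<open>alternation_from_adjacent_pairs\<close>).\<close>

section \<open>Alternations\<close>

fun alternation :: "'a \<Rightarrow> 'a \<Rightarrow> nat \<Rightarrow> 'a list" where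
  "alternation a b 0 = []"
| "alternation a b (Suc m) = a # alternation b a m"

lemma alternation_conv_map:
  "alternation a b m = map (\<lambda>i. if even i then a else b) [0..<m]"
proof (induction m arbitrary: a b)
  case 0
  then show ?case by simp
next
  case (Suc m)
  have "map (\<lambda>i. if even i then a else b) [0..<Suc m]
      = a # map (\<lambda>i. if even (Suc i) then a else b) [0..<m]"
    by (subst upt_conv_Cons) (simp_all add: map_Suc_upt[symmetric] del: upt_Suc)
  also have "\<dots> = a # map (\<lambda>i. if even i then b else a) [0..<m]"
    by simp
  finally show ?case using Suc by simp
qed

lemma contains_copy_alt_seq_iff:
  "contains_copy w (alt_seq s) \<longleftrightarrow> (\<exists>a b. a \<noteq> b \<and> subseq (alternation a b (s + 2)) w)"
proof -
  have set: "set (alt_seq s) = {0, 1}"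
    unfolding alt_seq_def by (force simp: image_iff)
  have map: "map f (alt_seq s) = alternation (f 0) (f 1) (s + 2)" for f :: "nat \<Rightarrow> 'a"
    unfolding alt_seq_def alternation_conv_map by simp
  show ?thesis
  proof
    assume "contains_copy w (alt_seq s)"
    then obtain f where "inj_on f {0, 1::nat}" "subseq (map f (alt_seq s)) w"
      unfolding contains_copy_def seq_iso_def set by blast
    then show "\<exists>a b. a \<noteq> b \<and> subseq (alternation a b (s + 2)) w"
      unfolding map by (intro exI[of _ "f 0"] exI[of _ "f 1"]) auto
  next
    assume "\<exists>a b. a \<noteq> b \<and> subseq (alternation a b (s + 2)) w"
    then obtain a b where ab: "a \<noteq> b" "subseq (alternation a b (s + 2)) w" by blast
    define f where "f = (\<lambda>i::nat. if i = 0 then a else b)"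
    have "inj_on f {0, 1}" "subseq (map f (alt_seq s)) w"
      using ab unfolding map by (auto simp: f_def)
    then show "contains_copy w (alt_seq s)"
      unfolding contains_copy_def seq_iso_def set by blast
  qed
qed

lemma count_list_alternation:
  assumes "a \<noteq> b"
  shows "count_list (alternation a b m) a = (m + 1) div 2"
    and "count_list (alternation a b m) b = m div 2"
  using assms by (induction m arbitrary: a b) auto

lemma set_alternation: "set (alternation a b m) \<subseteq> {a, b}"
  by (induction m arbitrary: a b) auto

lemma subseq_alternation_mono:
  "m \<le> m' \<Longrightarrow> subseq (alternation a b m) (alternation a b m')"
proof (induction m' arbitrary: m a b)
  case (Suc m')
  then show ?case by (cases m) auto
qed simp

lemma count_list_subseq: "subseq u w \<Longrightarrow> count_list u x \<le> count_list w x"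
  by (induction rule: list_emb.induct) auto

section \<open>Existence of saturated sequences\<close>

text \<open>Two adjacent occurrences of the pattern \<open>ab\<close> cannot overlap, because \<open>a\<close> and \<open>b\<close> differ;
  so the occurrences can be concatenated.\<close>

lemma alternation_from_adjacent_pairs:
  assumes "a \<noteq> b"
  shows "subseq (alternation a b (2 * count_list (zip w (tl w)) (a, b))) w"
proof (induction w rule: length_induct)
  case (1 w)
  show ?case
  proof (cases "\<exists>w'. w = a # b # w'")
    case True
    then obtain w' where w: "w = a # b # w'" by blast
    have "count_list (zip (b # w') w') (a, b) = count_list (zip w' (tl w')) (a, b)"
      using assms by (cases w') auto
    moreover have "subseq (alternation a b (2 * count_list (zip w' (tl w')) (a, b))) w'"
      using 1 w by simp
    ultimately show ?thesis using w by simp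
  next
    case False
    show ?thesis
    proof (cases w)
      case (Cons c w')
      have "count_list (zip w (tl w)) (a, b) = count_list (zip w' (tl w')) (a, b)"
        using False Cons by (cases w') auto
      moreover have "subseq (alternation a b (2 * count_list (zip w' (tl w')) (a, b))) w'"
        using 1 Cons by simp
      ultimately show ?thesis using Cons by (simp add: list_emb_Cons)
    qed simp
  qed
qed

lemma distinct_adj_not_in_zip_tl:
  "distinct_adj w \<Longrightarrow> (a, a) \<notin> set (zip w (tl w))"
proof (induction w rule: induct_list012)
  case (3 x y zs)
  then show ?case by auto
qed auto

lemma length_bound_of_free:
  assumes "finite A" "set w \<subseteq> A" "distinct_adj w" "seq_free (alt_seq s) w"
  shows "length w \<le> card (A \<times> A) * (s + 2) + 1"
proof -
  let ?z = "zip w (tl w)"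
  have sub: "set ?z \<subseteq> A \<times> A"
  proof
    fix p assume p: "p \<in> set ?z"
    obtain a b where ab: "p = (a, b)" by (cases p)
    have "a \<in> set w" "b \<in> set (tl w)"
      using p unfolding ab by (rule set_zip_leftD, rule set_zip_rightD)
    moreover have "set (tl w) \<subseteq> set w" by (cases w) auto
    ultimately show "p \<in> A \<times> A" using assms(2) ab by blast
  qed
  have bound: "count_list ?z p \<le> s + 2" for p
  proof (cases p)
    case (Pair a b)
    show ?thesis
    proof (cases "a = b")
      case True
      then show ?thesis using distinct_adj_not_in_zip_tl[OF assms(3)] Pair
        by (simp add: count_notin)
    next
      case False
      show ?thesis
      proof (rule ccontr)
        assume "\<not> ?thesis"
        then have "s + 2 \<le> 2 * count_list ?z (a, b)" using Pair by simp
        then have "subseq (alternation a b (s + 2)) w"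
          by (rule subseq_order.order_trans[OF subseq_alternation_mono
                alternation_from_adjacent_pairs[OF False]])
        then show False using assms(4) False contains_copy_alt_seq_iff by blast
      qed
    qed
  qed
  have "length w - 1 = length ?z" by simp
  also have "\<dots> = sum (count_list ?z) (A \<times> A)"
    using sum_count_set[OF sub] assms(1) by simp
  also have "\<dots> \<le> card (A \<times> A) * (s + 2)"
    using sum_bounded_above[of "A \<times> A" "count_list ?z" "s + 2"] bound by simp
  finally show ?thesis by simp
qed

lemma saturated_exists:
  assumes "finite A"
  shows "\<exists>w. alt_saturated A s w"
proof -
  let ?P = "\<lambda>w. set w \<subseteq> A \<and> distinct_adj w \<and> seq_free (alt_seq s) w"
  have "?P []"
    unfolding contains_copy_alt_seq_iff by simp
  moreover have "\<forall>w. ?P w \<longrightarrow> length w < card (A \<times> A) * (s + 2) + 2"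
    using length_bound_of_free[OF assms] by (simp add: le_imp_less_Suc)
  ultimately obtain w where w: "?P w" "\<And>w'. ?P w' \<Longrightarrow> length w' \<le> length w"
    using Lattices_Big.ex_has_greatest_nat[of ?P "[]" length] by blast
  have "\<not> distinct_adj (p @ x # q) \<or> contains_copy (p @ x # q) (alt_seq s)"
    if "x \<in> A" "w = p @ q" for x p q
    using w(2)[of "p @ x # q"] w(1) that by auto
  then show ?thesis using w(1) unfolding alt_saturated_def by blast
qed

section \<open>What an insertion creates\<close>

lemma insertion_creates_alternation:
  assumes "alt_saturated A s w" "x \<in> A" "w = p @ q" "distinct_adj (p @ x # q)"
  obtains a b where "a \<noteq> b" "x \<in> {a, b}" "subseq (alternation a b (s + 2)) (p @ x # q)"
proof -
  have free: "\<And>a b. a \<noteq> b \<Longrightarrow> \<not> subseq (alternation a b (s + 2)) w"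
    using assms(1) unfolding alt_saturated_def contains_copy_alt_seq_iff by blast
  obtain a b where ab: "a \<noteq> b" "subseq (alternation a b (s + 2)) (p @ x # q)"
    using assms unfolding alt_saturated_def contains_copy_alt_seq_iff by blast
  have "x \<in> {a, b}"
  proof (rule ccontr)
    assume "x \<notin> {a, b}"
    then have "filter (\<lambda>y. y \<noteq> x) (alternation a b (s + 2)) = alternation a b (s + 2)"
      using set_alternation by (fastforce intro: filter_True)
    then have "subseq (alternation a b (s + 2)) (filter (\<lambda>y. y \<noteq> x) (p @ x # q))"
      using subseq_filter[OF ab(2), of "\<lambda>y. y \<noteq> x"] by simp
    moreover have "filter (\<lambda>y. y \<noteq> x) (p @ x # q) = filter (\<lambda>y. y \<noteq> x) w"
      using assms(3) by simp
    ultimately have "subseq (alternation a b (s + 2)) w"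
      by (metis subseq_filter_left subseq_order.order_trans)
    then show False using free ab(1) by blast
  qed
  then show ?thesis using that ab by blast
qed

text \<open>The alternation accounts for \<open>s + 2\<close> occurrences of \<open>x\<close> and its partner \<open>y\<close>, and only
  one of them, an \<open>x\<close>, is new. Which of the two takes the larger half is not known, so \<open>y\<close> is
  only guaranteed the smaller one.\<close>

lemma counts_from_insertion:
  assumes "alt_saturated A s w" "x \<in> A" "w = p @ q" "distinct_adj (p @ x # q)"
  obtains y where "y \<in> A" "y \<noteq> x" "count_list w y \<ge> (s + 2) div 2"
    "count_list w x + count_list w y \<ge> s + 1"
proof -
  obtain a b where ab: "a \<noteq> b" "x \<in> {a, b}" "subseq (alternation a b (s + 2)) (p @ x # q)"
    using insertion_creates_alternation[OF assms] by blast
  define y where "y = (if x = a then b else a)"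
  have "(s + 2 + 1) div 2 \<le> count_list (p @ x # q) a"
    using count_list_subseq[OF ab(3), of a] unfolding count_list_alternation(1)[OF ab(1)] .
  moreover have "(s + 2) div 2 \<le> count_list (p @ x # q) b"
    using count_list_subseq[OF ab(3), of b] unfolding count_list_alternation(2)[OF ab(1)] .
  ultimately have c: "y \<noteq> x" "count_list w y \<ge> (s + 2) div 2"
    "count_list w x + count_list w y \<ge> s + 1"
    using ab(1,2) assms(3) by (auto simp: y_def split: if_splits)
  then have "count_list w y \<noteq> 0" by simp
  then have "y \<in> set w" by (metis count_notin)
  then have "y \<in> A" using assms(1) unfolding alt_saturated_def by blast
  then show ?thesis using that c by blast
qed

text \<open>Such a letter can be inserted at the front. The alternation thus created is not contained in
  \<open>w\<close>, so it begins with the inserted letter, which therefore takes the larger half of the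
  \<open>s + 2\<close> positions.\<close>

lemma count_of_nonfirst_letter:
  assumes "alt_saturated A s w" "x \<in> A" "w = [] \<or> hd w \<noteq> x"
  shows "count_list w x \<ge> (s + 1) div 2"
proof -
  have d: "distinct_adj (x # w)"
    using assms unfolding alt_saturated_def by (cases w) auto
  obtain a b where ab: "a \<noteq> b" "subseq (alternation a b (s + 2)) (x # w)"
    using insertion_creates_alternation[OF assms(1,2) append_Nil[symmetric]] d
    by (metis append_Nil)
  have "\<not> subseq (alternation a b (s + 2)) w"
    using assms(1) ab(1) unfolding alt_saturated_def contains_copy_alt_seq_iff by blast
  then have "a = x" using ab(2) by (auto split: if_splits)
  then show ?thesis
    using count_list_subseq[OF ab(2), of a] unfolding count_list_alternation(1)[OF ab(1)] by simp
qed

text \<open>When every gap of \<open>w\<close>, including the two ends, is next to an \<open>x\<close>, the word is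
  \<open>x\<close>, then a letter, then \<open>x\<close>, and so on, ending in \<open>x\<close>.\<close>

lemma length_if_not_insertable:
  assumes "distinct_adj w" "\<And>p q. w = p @ q \<Longrightarrow> \<not> distinct_adj (p @ x # q)"
  shows "length w \<le> 2 * count_list w x"
  using assms
proof (induction w rule: length_induct)
  case (1 w)
  note d = 1(2) and no = 1(3)
  obtain w1 where w: "w = x # w1"
    using no[of "[]" w] d by (cases w) auto
  show ?case
  proof (cases w1)
    case (Cons b w2)
    have b: "b \<noteq> x" using d w Cons by auto
    obtain w3 where w2: "w2 = x # w3"
      using no[of "[x, b]" w2] d w Cons b by (cases w2) auto
    have "\<not> distinct_adj (p @ x # q)" if pq: "w2 = p @ q" for p q
    proof
      assume i: "distinct_adj (p @ x # q)"
      have "p \<noteq> []" using i pq w2 by auto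
      then have "hd p = x" using pq w2 by (cases p) auto
      then have "distinct_adj (x # b # p @ x # q)"
        using i b \<open>p \<noteq> []\<close> by (cases p) auto
      then show False using no[of "x # b # p" q] w Cons pq by simp
    qed
    moreover have "distinct_adj w2" using d w Cons w2 by auto
    ultimately have "length w2 \<le> 2 * count_list w2 x"
      using 1(1) w Cons by simp
    then show ?thesis using w Cons by simp
  qed (use w in simp)
qed

section \<open>The lower bound\<close>

text \<open>If \<open>x\<close> cannot be inserted anywhere, it makes up at least half of \<open>w\<close>. The other letters
  together are then no more frequent than \<open>x\<close>, and already one of them occurs
  \<open>\<lceil>s/2\<rceil>\<close> times.\<close>

lemma count_of_first_letter:
  assumes sat: "alt_saturated A s w" and fin: "finite A" and card: "card A \<ge> 3"
    and x: "x \<in> A" and others: "\<And>y. y \<in> A - {x} \<Longrightarrow> count_list w y \<ge> (s + 1) div 2"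
  shows "count_list w x \<ge> (s + 1) div 2 \<or>
    (\<exists>y \<in> A - {x}. count_list w x + count_list w y \<ge> s + 1)"
proof (cases "\<exists>p q. w = p @ q \<and> distinct_adj (p @ x # q)")
  case True
  then show ?thesis using counts_from_insertion[OF sat x] by (metis DiffI singletonD)
next
  case False
  have "length w \<le> 2 * count_list w x"
    using length_if_not_insertable[of w x] False sat unfolding alt_saturated_def by blast
  moreover have "length w = count_list w x + sum (count_list w) (A - {x})"
    using sum_count_set[of w A] sum.remove[OF fin x, of "count_list w"] fin sat
    unfolding alt_saturated_def by simp
  moreover have "card (A - {x}) * ((s + 1) div 2) \<le> sum (count_list w) (A - {x})"
    using sum_bounded_below[of "A - {x}" "(s + 1) div 2" "count_list w"] others by simp
  moreover have "1 * ((s + 1) div 2) \<le> card (A - {x}) * ((s + 1) div 2)"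
    using card x by (intro mult_le_mono1) simp
  ultimately show ?thesis by linarith
qed

lemma length_of_saturated:
  assumes sat: "alt_saturated A s w" and fin: "finite A" and card: "card A \<ge> 3"
  shows "length w \<ge> card A * ((s + 1) div 2) + (if even s then 1 else 0)"
proof -
  let ?m = "(s + 1) div 2" and ?c = "count_list w"
  have len: "length w = sum ?c A"
    using sum_count_set[of w A] fin sat unfolding alt_saturated_def by simp
  have wne: "w \<noteq> []"
  proof
    assume "w = []"
    moreover obtain x where "x \<in> A" using card by fastforce
    ultimately obtain y where "?c y \<ge> (s + 2) div 2"
      using counts_from_insertion[OF sat, of x "[]" "[]"] by auto
    then show False using \<open>w = []\<close> by simp
  qed
  define x where "x = hd w"
  have x: "x \<in> A" using wne sat unfolding x_def alt_saturated_def by auto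
  have others: "?c y \<ge> ?m" if "y \<in> A - {x}" for y
    using count_of_nonfirst_letter[OF sat, of y] that unfolding x_def by auto
  have cardx: "card (A - {x}) = card A - 1" using x fin by simp
  have pair: "sum ?c A \<ge> (card A - 2) * ?m + (?c x + ?c y)" if "y \<in> A - {x}" for y
  proof -
    have "sum ?c A = ?c x + (?c y + sum ?c (A - {x} - {y}))"
      using sum.remove[OF fin x, of ?c] sum.remove[of "A - {x}" y ?c] that fin by simp
    moreover have "card (A - {x} - {y}) = card A - 2" using that x fin by simp
    moreover have "card (A - {x} - {y}) * ?m \<le> sum ?c (A - {x} - {y})"
      using sum_bounded_below[of "A - {x} - {y}" ?m ?c] others by simp
    ultimately show ?thesis by simp
  qed
  have split: "card A * ?m = (card A - 2) * ?m + 2 * ?m"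
  proof -
    have "card A = (card A - 2) + 2" using card by simp
    then show ?thesis by (metis add_mult_distrib)
  qed
  note first = count_of_first_letter[OF sat fin card x others]
  show ?thesis
  proof (cases "even s")
    case False
    then have m: "2 * ?m = s + 1" by simp
    from first show ?thesis
    proof
      assume "?c x \<ge> ?m"
      then have "?c y \<ge> ?m" if "y \<in> A" for y using others that by (cases "y = x") auto
      then show ?thesis
        using sum_bounded_below[of A ?m ?c] len False by simp
    next
      assume "\<exists>y \<in> A - {x}. ?c x + ?c y \<ge> s + 1"
      then obtain y where "y \<in> A - {x}" "?c x + ?c y \<ge> s + 1" by blast
      then show ?thesis using pair[of y] split m len False by simp
    qed
  next
    case True
    then have m: "2 * ?m = s" "(s + 2) div 2 = ?m + 1" by auto
    \<comment> \<open>The average alone gives \<open>n * (s/2)\<close>. A pair sharing \<open>s + 1\<close> occurrences is already one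
      above it; without such a pair, the additional occurrence belongs to the partner of a letter
      \<open>z\<close> inserted at the front.\<close>
    from first show ?thesis
    proof
      assume cx: "?c x \<ge> ?m"
      have all: "?c y \<ge> ?m" if "y \<in> A" for y using others that cx by (cases "y = x") auto
      have "A - {x} \<noteq> {}" using cardx card by (intro notI) simp
      then obtain z where z: "z \<in> A" "z \<noteq> x" by blast
      have "distinct_adj (z # w)"
        using z(2) sat wne unfolding x_def alt_saturated_def by (cases w) auto
      then obtain y where y: "y \<in> A" "?c y \<ge> ?m + 1"
        using counts_from_insertion[OF sat z(1), of "[]" w] m(2) by auto
      have "sum (\<lambda>_. ?m) A < sum ?c A"
      proof (rule sum_strict_mono_ex1)
        show "\<exists>y \<in> A. ?m < ?c y" using y by (intro bexI[of _ y]) simp_all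
      qed (use fin all in auto)
      then show ?thesis using len True by simp
    next
      assume "\<exists>y \<in> A - {x}. ?c x + ?c y \<ge> s + 1"
      then obtain y where "y \<in> A - {x}" "?c x + ?c y \<ge> s + 1" by blast
      then show ?thesis using pair[of y] split m len True by simp
    qed
  qed
qed

theorem lemma2p3:
  fixes n s :: nat
  assumes "n \<ge> 3" and "s \<ge> 1"
  shows "(even s \<longrightarrow> \<xi> n s \<ge> n * (s div 2) + 1) \<and>
         (odd s \<longrightarrow> \<xi> n s \<ge> n * (s div 2) + 3)"
proof -
  let ?Q = "\<lambda>l. \<exists>(A :: nat set) w.
     finite A \<and> card A = n \<and> alt_saturated A s w \<and> length w = l"
  obtain w where "alt_saturated {..<n} s w"
    using saturated_exists[of "{..<n}" s] by blast
  then have "?Q (length w)"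
    by (intro exI[of _ "{..<n}"] exI[of _ w]) simp
  then have "?Q (\<xi> n s)"
    unfolding \<xi>_def by (rule LeastI)
  then obtain A :: "nat set" and w where Aw: "finite A" "card A = n" "alt_saturated A s w"
    "length w = \<xi> n s" by blast
  have len: "\<xi> n s \<ge> n * ((s + 1) div 2) + (if even s then 1 else 0)"
    using length_of_saturated[OF Aw(3,1)] Aw(2,4) assms(1) by simp
  show ?thesis
  proof (cases "even s")
    case True
    then show ?thesis using len by simp
  next
    case False
    then have "(s + 1) div 2 = s div 2 + 1" by simp
    then show ?thesis using len False assms(1) by simp
  qed
qed

end
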